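(* For every positive integer $\beta$, the number of $(1,\beta)$-BM relations is \[ |R_{1,\beta}| = \prod_{i=1}^{\beta} (2i+1). \]
   Context: Let $\alpha,\beta$ be positive integers, $A_{\alpha}=\{a_1,\ldots,a_{\alpha}\}$, $B_{\beta}=\{b_1,\ldots,b_{\beta}\}$ (disjoint sets of letters), and let $A_{\alpha}^{\pm1}$, $B_{\beta}^{\pm1}$ be the sets of $2\alpha$, respectively $2\beta$, distinct formal symbols consisting of the letters and their formal inverses, with $(x^{-1})^{-1}=x$. For $a,a'\in A_{\alpha}^{\pm1}$ and $b,b'\in B_{\beta}^{\pm1}$ the geometric square $[aba'b']$ is the set of words \[ [aba'b'] := \{aba'b',\; a'b'ab,\; a^{-1}b'^{-1}a'^{-1}b^{-1},\; a'^{-1}b^{-1}a^{-1}b'^{-1}\}. \] $GS_{\alpha,\beta}$ denotes the set of all geometric squares $[aba'b']$ with $a,a'\in A_{\alpha}^{\pm1}$, $b,b'\in B_{\beta}^{\pm1}$. For $S\subseteq GS_{\alpha,\beta}$ the link $Lk(S)$ is the undirected simple graph with vertex set $A_{\alpha}^{\pm1}\sqcup B_{\beta}^{\pm1}$ and edges $\{a^{-1},b\}$, $\{a',b^{-1}\}$, $\{a'^{-1},b'\}$, $\{a,b'^{-1}\}$ for each $[aba'b']\in S$. An $(\alpha,\beta)$-BM relation is a set $R\subseteq GS_{\alpha,\beta}$ consisting of exactly $\alpha\beta$ geometric squares such that $Lk(R)$ is the complete bipartite graph $K_{2\alpha,2\beta}$ with respect to the decomposition $A_{\alpha}^{\pm1}\sqcup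 B_{\beta}^{\pm1}$. $R_{\alpha,\beta}$ denotes the set of all $(\alpha,\beta)$-BM relations. *)

theory Defs
  imports Main
begin

datatype letter = La nat | Lb nat

datatype symbol = Pos letter | Neg letter

fun sinv :: "symbol \<Rightarrow> symbol" where
  "sinv (Pos x) = Neg x"
| "sinv (Neg x) = Pos x"

lemma sinv_sinv [simp]: "sinv (sinv x) = x"
  by (cases x) simp_all

definition Asym :: "nat \<Rightarrow> symbol set" where
  "Asym \<alpha> = (\<Union>i\<in>{1..\<alpha>}. {Pos (La i), Neg (La i)})"

definition Bsym :: "nat \<Rightarrow> symbol set" where
  "Bsym \<beta> = (\<Union>j\<in>{1..\<beta>}. {Pos (Lb j), Neg (Lb j)})"

text \<open>Words are plain lists of symbols; no free reduction takes place.\<close>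

type_synonym word = "symbol list"

definition gsquare :: "symbol \<Rightarrow> symbol \<Rightarrow> symbol \<Rightarrow> symbol \<Rightarrow> word set" where
  "gsquare a b a' b' =
     {[a, b, a', b'],
      [a', b', a, b],
      [sinv a, sinv b', sinv a', sinv b],
      [sinv a', sinv b, sinv a, sinv b']}"

definition GS :: "nat \<Rightarrow> nat \<Rightarrow> word set set" where
  "GS \<alpha> \<beta> = {gsquare a b a' b' | a b a' b'.
     a \<in> Asym \<alpha> \<and> a' \<in> Asym \<alpha> \<and> b \<in> Bsym \<beta> \<and> b' \<in> Bsym \<beta>}"

text \<open>An undirected simple graph is a pair of a vertex set and a set of two-element edges.\<close>

type_synonym 'v ugraph = "'v set \<times> 'v set set"

definition square_edges :: "symbol \<Rightarrow> symbol \<Rightarrow> symbol \<Rightarrow> symbol \<Rightarrow> symbol set set" where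
  "square_edges a b a' b' = {{sinv a, b}, {a', sinv b}, {sinv a', b'}, {a, sinv b'}}"

text \<open>The union ranges over all representatives of each square; they all give the same edges.\<close>

definition Lk :: "nat \<Rightarrow> nat \<Rightarrow> word set set \<Rightarrow> symbol ugraph" where
  "Lk \<alpha> \<beta> S =
     (Asym \<alpha> \<union> Bsym \<beta>,
      \<Union>{square_edges a b a' b' | a b a' b'.
         a \<in> Asym \<alpha> \<and> a' \<in> Asym \<alpha> \<and> b \<in> Bsym \<beta> \<and> b' \<in> Bsym \<beta> \<and> gsquare a b a' b' \<in> S})"

lemma square_edges_well_defined:
  assumes "gsquare a b a' b' = gsquare c d c' d'"
  shows "square_edges a b a' b' = square_edges c d c' d'"
proof -
  have "[c, d, c', d'] \<in> gsquare a b a' b'"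
    unfolding assms by (subst gsquare_def) (rule insertI1)
  then consider "c = a" "d = b" "c' = a'" "d' = b'"
    | "c = a'" "d = b'" "c' = a" "d' = b"
    | "c = sinv a" "d = sinv b'" "c' = sinv a'" "d' = sinv b"
    | "c = sinv a'" "d = sinv b" "c' = sinv a" "d' = sinv b'"
    unfolding gsquare_def by (elim insertE emptyE) simp_all
  then show ?thesis
    unfolding square_edges_def by cases (simp_all only: sinv_sinv insert_commute)
qed

definition complete_bipartite :: "'v set \<Rightarrow> 'v set \<Rightarrow> 'v ugraph" where
  "complete_bipartite V W = (V \<union> W, {{v, w} | v w. v \<in> V \<and> w \<in> W})"

definition BM_relation :: "nat \<Rightarrow> nat \<Rightarrow> word set set \<Rightarrow> bool" where
  "BM_relation \<alpha> \<beta> R \<longleftrightarrow>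
     R \<subseteq> GS \<alpha> \<beta> \<and> card R = \<alpha> * \<beta> \<and>
     Lk \<alpha> \<beta> R = complete_bipartite (Asym \<alpha>) (Bsym \<beta>)"

definition BM_relations :: "nat \<Rightarrow> nat \<Rightarrow> word set set set" where
  "BM_relations \<alpha> \<beta> = {R. BM_relation \<alpha> \<beta> R}"

end

theory Submission
  imports Defs "HOL-Library.Disjoint_Sets"
begin

text \<open>Each edge of the link comes from a corner \<open>(a, b)\<close>, the first two letters of a word of a
  square. As a square has at most four corners and the complete bipartite graph has \<open>4\<alpha>\<beta>\<close> edges, a BM relation is
  the same thing as an exact cover of all corners by squares with four distinct corners. For
  \<open>\<alpha> = 1\<close> such a square is either parallel, \<open>[abac]\<close> with \<open>b \<noteq> c\<close>, or crossing,
  \<open>[aba\<^sup>-\<^sup>1c]\<close>. In a BM relation the letters occurring in crossing squares form an arbitrary set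
  of some size \<open>k\<close>; the crossing squares are a signed permutation of it, which gives \<open>2\<^sup>k k!\<close>
  choices, and the parallel squares are a perfect matching on the remaining \<open>2(\<beta> - k)\<close> symbols.\<close>

section \<open>Exact covers\<close>

text \<open>A cover consists of indices \<open>q\<close> and not of the sets \<open>e q\<close>,
  because different squares can have the same corners: \<open>crossing_square b c\<close> and
  \<open>crossing_square b (sinv c)\<close> do. Such covers must be counted separately.\<close>

definition exact_covers :: "('q \<Rightarrow> 'c set) \<Rightarrow> 'q set \<Rightarrow> 'c set \<Rightarrow> 'q set set" where
  "exact_covers e Q X = {R. R \<subseteq> Q \<and> disjoint_family_on e R \<and> \<Union>(e ` R) = X}"

lemma finite_exact_covers: "finite Q \<Longrightarrow> finite (exact_covers e Q X)"
  by (rule finite_subset[of _ "Pow Q"]) (auto simp: exact_covers_def)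

lemma exact_covers_empty:
  assumes "\<And>q. q \<in> Q \<Longrightarrow> e q \<noteq> {}"
  shows "exact_covers e Q {} = {{}}"
  using assms by (fastforce simp: exact_covers_def disjoint_family_on_def)

lemma insert_mem_exact_covers_iff:
  assumes "q \<notin> R"
  shows "insert q R \<in> exact_covers e Q X \<longleftrightarrow>
    q \<in> Q \<and> e q \<subseteq> X \<and> R \<in> exact_covers e Q (X - e q)"
proof -
  \<comment> \<open>Disjointness from the rest and covering \<open>X\<close> together say that the
    rest covers exactly the complement of \<open>e q\<close>.\<close>
  have "e q \<inter> \<Union>(e ` R) = {} \<and> e q \<union> \<Union>(e ` R) = X \<longleftrightarrow> e q \<subseteq> X \<and> \<Union>(e ` R) = X - e q"
    by blast
  then show ?thesis
    unfolding exact_covers_def mem_Collect_eq disjoint_family_on_insert[OF assms]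
      insert_subset image_insert Union_insert by argo
qed

text \<open>The branching step of exact cover search: exactly one member contains the chosen point
  \<open>x\<close>, and the other members cover what it leaves.\<close>

lemma exact_covers_choose:
  assumes x: "x \<in> X"
  shows "exact_covers e Q X =
    (\<Union>q\<in>{q\<in>Q. x \<in> e q \<and> e q \<subseteq> X}. insert q ` exact_covers e Q (X - e q))" (is "?L = ?R")
proof
  show "?L \<subseteq> ?R"
  proof
    fix R assume R: "R \<in> ?L"
    then have "\<Union>(e ` R) = X"
      by (simp add: exact_covers_def)
    with x obtain q where q: "q \<in> R" "x \<in> e q"
      by blast
    have ins: "R = insert q (R - {q})"
      using q by blast
    then have "insert q (R - {q}) \<in> ?L"
      using R by simp
    then have "q \<in> Q \<and> e q \<subseteq> X \<and> R - {q} \<in> exact_covers e Q (X - e q)"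
      by (subst (asm) insert_mem_exact_covers_iff) auto
    with q ins show "R \<in> ?R"
      by blast
  qed
  show "?R \<subseteq> ?L"
  proof
    fix R assume "R \<in> ?R"
    then obtain q R' where *: "q \<in> Q" "x \<in> e q" "e q \<subseteq> X"
      "R' \<in> exact_covers e Q (X - e q)" "R = insert q R'"
      by blast
    then have "q \<notin> R'"
      unfolding exact_covers_def by blast
    with * show "R \<in> ?L"
      by (simp add: insert_mem_exact_covers_iff)
  qed
qed

lemma card_exact_covers_choose:
  assumes x: "x \<in> X" and fin: "finite Q"
  shows "card (exact_covers e Q X) =
    (\<Sum>q\<in>{q\<in>Q. x \<in> e q \<and> e q \<subseteq> X}. card (exact_covers e Q (X - e q)))"
proof -
  let ?C = "{q\<in>Q. x \<in> e q \<and> e q \<subseteq> X}"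
  let ?F = "\<lambda>q. insert q ` exact_covers e Q (X - e q)"
  \<comment> \<open>After \<open>e q\<close> is removed no remaining member contains
    \<open>x\<close>. This makes the branches disjoint and also makes inserting \<open>q\<close>
    injective.\<close>
  have notin: "q' \<notin> R" if "x \<in> e q'" "x \<in> e q" "R \<in> exact_covers e Q (X - e q)" for q q' R
    using that by (auto simp: exact_covers_def)
  have "card (exact_covers e Q X) = card (\<Union>q\<in>?C. ?F q)"
    by (simp add: exact_covers_choose[OF x])
  also have "\<dots> = (\<Sum>q\<in>?C. card (?F q))"
  proof (rule card_UN_disjoint)
    show "\<forall>i\<in>?C. \<forall>j\<in>?C. i \<noteq> j \<longrightarrow> ?F i \<inter> ?F j = {}"
      using notin by blast
  qed (auto simp: fin finite_exact_covers)
  also have "\<dots> = (\<Sum>q\<in>?C. card (exact_covers e Q (X - e q)))"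
  proof (rule sum.cong[OF refl])
    fix q assume "q \<in> ?C"
    then have "\<And>R. R \<in> exact_covers e Q (X - e q) \<Longrightarrow> q \<notin> R"
      using notin by blast
    then have "inj_on (insert q) (exact_covers e Q (X - e q))"
      by (intro inj_onI) (metis insert_ident)
    then show "card (?F q) = card (exact_covers e Q (X - e q))"
      by (rule card_image)
  qed
  finally show ?thesis .
qed

text \<open>The set \<open>Y\<close> is the region covered by the members taken from
  \<open>N\<close>; once it is fixed, the two partial covers are chosen independently.\<close>

lemma exact_covers_Un:
  "exact_covers e (M \<union> N) X =
    (\<Union>Y\<in>Pow X. (\<lambda>(R, R'). R \<union> R') ` (exact_covers e M (X - Y) \<times> exact_covers e N Y))"
  (is "?L = ?R")
proof
  show "?L \<subseteq> ?R"
  proof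
    fix R assume "R \<in> ?L"
    then have R: "R \<subseteq> M \<union> N" "disjoint_family_on e R" "\<Union>(e ` R) = X"
      by (simp_all add: exact_covers_def)
    let ?R1 = "R \<inter> M" and ?R2 = "R - M"
    let ?Y = "\<Union>(e ` ?R2)"
    have "e q \<inter> e r = {}" if "q \<in> ?R1" "r \<in> ?R2" for q r
      using disjoint_family_onD[OF R(2), of q r] that by blast
    then have "\<Union>(e ` ?R1) = X - ?Y"
      using R(3) by blast
    moreover have "disjoint_family_on e ?R1" "disjoint_family_on e ?R2"
      using R(2) by (rule disjoint_family_on_mono[rotated]; blast)+
    ultimately have "?R1 \<in> exact_covers e M (X - ?Y)" "?R2 \<in> exact_covers e N ?Y"
      using R(1) unfolding exact_covers_def by blast+
    moreover have "?Y \<in> Pow X"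
      using R(3) by blast
    moreover have "R = (\<lambda>(R, R'). R \<union> R') (?R1, ?R2)"
      by auto
    ultimately show "R \<in> ?R"
      by blast
  qed
  show "?R \<subseteq> ?L"
  proof
    fix R assume "R \<in> ?R"
    then obtain Y R1 R2 where *: "Y \<subseteq> X" "R1 \<in> exact_covers e M (X - Y)"
      "R2 \<in> exact_covers e N Y" "R = R1 \<union> R2"
      by auto
    then have U: "\<Union>(e ` R1) = X - Y" "\<Union>(e ` R2) = Y"
      and D: "disjoint_family_on e R1" "disjoint_family_on e R2"
      by (simp_all add: exact_covers_def)
    have "e q \<inter> e r = {}" if "q \<in> R1" "r \<in> R2" for q r
      using that U by blast
    then have "disjoint_family_on e (R1 \<union> R2)"
      using D unfolding disjoint_family_on_def by blast
    moreover have "\<Union>(e ` (R1 \<union> R2)) = X"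
      using U \<open>Y \<subseteq> X\<close> by auto
    moreover have "R1 \<union> R2 \<subseteq> M \<union> N"
      using * unfolding exact_covers_def by blast
    ultimately show "R \<in> ?L"
      unfolding exact_covers_def \<open>R = R1 \<union> R2\<close> by blast
  qed
qed

lemma card_exact_covers_Un:
  assumes fin: "finite M" "finite N" "finite X" and MN: "M \<inter> N = {}"
  shows "card (exact_covers e (M \<union> N) X) =
    (\<Sum>Y\<in>Pow X. card (exact_covers e M (X - Y)) * card (exact_covers e N Y))"
proof -
  let ?u = "\<lambda>(R, R'). R \<union> R'"
  let ?F = "\<lambda>Y. exact_covers e M (X - Y) \<times> exact_covers e N Y"
  \<comment> \<open>The union determines both partial covers and the region \<open>Y\<close>, so
    nothing is counted twice.\<close>
  have parts: "(R \<union> R') \<inter> M = R" "(R \<union> R') \<inter> N = R'" "\<Union>(e ` R') = Y"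
    if "(R, R') \<in> ?F Y" for R R' Y
  proof -
    have "R \<subseteq> M" "R' \<subseteq> N" "\<Union>(e ` R') = Y"
      using that by (simp_all add: exact_covers_def)
    with MN show "(R \<union> R') \<inter> M = R" "(R \<union> R') \<inter> N = R'" "\<Union>(e ` R') = Y"
      by blast+
  qed
  have "card (exact_covers e (M \<union> N) X) = (\<Sum>Y\<in>Pow X. card (?u ` ?F Y))"
    unfolding exact_covers_Un
  proof (rule card_UN_disjoint)
    show "\<forall>Y\<in>Pow X. \<forall>Z\<in>Pow X. Y \<noteq> Z \<longrightarrow> ?u ` ?F Y \<inter> ?u ` ?F Z = {}"
    proof (intro ballI impI, rule ccontr)
      fix Y Z assume "Y \<noteq> Z" "?u ` ?F Y \<inter> ?u ` ?F Z \<noteq> {}"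
      then obtain R R' S S' where "(R, R') \<in> ?F Y" "(S, S') \<in> ?F Z" "R \<union> R' = S \<union> S'"
        by fast
      with parts \<open>Y \<noteq> Z\<close> show False
        by metis
    qed
  qed (auto simp: fin finite_exact_covers)
  also have "\<dots> = (\<Sum>Y\<in>Pow X. card (?F Y))"
  proof (rule sum.cong[OF refl], rule card_image, rule inj_onI)
    fix Y u v assume "u \<in> ?F Y" "v \<in> ?F Y" "?u u = ?u v"
    then show "u = v"
      using parts by (cases u; cases v) (metis case_prod_conv)
  qed
  finally show ?thesis
    by (simp add: card_cartesian_product)
qed

section \<open>Corners of geometric squares\<close>

text \<open>Phrased through the words of \<open>q\<close>, so that no representative of the square
  has to be chosen.\<close>

definition corners :: "word set \<Rightarrow> (symbol \<times> symbol) set" where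
  "corners q = {(a, b). \<exists>a' b'. [a, b, a', b'] \<in> q}"

lemma corners_gsquare:
  "corners (gsquare a b a' b') = {(a, b), (a', b'), (sinv a, sinv b'), (sinv a', sinv b)}"
  by (auto simp: corners_def gsquare_def)

lemma sinv_neq [simp]: "sinv x \<noteq> x" "x \<noteq> sinv x"
  by (cases x; simp)+

lemma sinv_eq_iff [simp]: "sinv x = sinv y \<longleftrightarrow> x = y"
  by (metis sinv_sinv)

lemma sinv_Asym [simp]: "sinv x \<in> Asym \<alpha> \<longleftrightarrow> x \<in> Asym \<alpha>"
  by (cases x) (auto simp: Asym_def)

lemma sinv_Bsym [simp]: "sinv x \<in> Bsym \<beta> \<longleftrightarrow> x \<in> Bsym \<beta>"
  by (cases x) (auto simp: Bsym_def)

lemma Asym_Int_Bsym: "Asym \<alpha> \<inter> Bsym \<beta> = {}"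
  by (auto simp: Asym_def Bsym_def)

lemma card_letters:
  assumes "finite J" "inj f"
  shows "card (\<Union>j\<in>J. {Pos (f j), Neg (f j)}) = 2 * card J"
  using assms by (subst card_UN_disjoint) (auto simp: inj_eq)

lemma card_Asym: "card (Asym \<alpha>) = 2 * \<alpha>"
  unfolding Asym_def by (subst card_letters) (auto intro: injI)

lemma finite_Asym [simp]: "finite (Asym \<alpha>)"
  by (simp add: Asym_def)

lemma finite_Bsym [simp]: "finite (Bsym \<beta>)"
  by (simp add: Bsym_def)

lemma card_Bsym: "card (Bsym \<beta>) = 2 * \<beta>"
  unfolding Bsym_def by (subst card_letters) (auto intro: injI)

definition corner_edge :: "symbol \<times> symbol \<Rightarrow> symbol set" where
  "corner_edge = (\<lambda>(a, b). {sinv a, b})"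

text \<open>Each of the four words contributes one edge through its first two letters; for instance
  \<open>{a', sinv b}\<close> comes from the word that begins with \<open>sinv a'\<close>,
  \<open>sinv b\<close>.\<close>

lemma square_edges_corners: "square_edges a b a' b' = corner_edge ` corners (gsquare a b a' b')"
  by (auto simp: square_edges_def corners_gsquare corner_edge_def)

text \<open>The two alphabets are disjoint and closed under inversion, so an unordered edge reveals
  which of its ends came from which alphabet.\<close>

lemma inj_on_corner_edge: "inj_on corner_edge (Asym \<alpha> \<times> Bsym \<beta>)"
proof (rule inj_onI, clarify)
  fix a b c d
  assume *: "a \<in> Asym \<alpha>" "b \<in> Bsym \<beta>" "c \<in> Asym \<alpha>" "d \<in> Bsym \<beta>"
    and "corner_edge (a, b) = corner_edge (c, d)"
  then have "{sinv a, b} = {sinv c, d}"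
    by (simp add: corner_edge_def)
  moreover have "sinv a \<noteq> d" "sinv c \<noteq> b"
    using * Asym_Int_Bsym[of \<alpha> \<beta>] by (metis IntI empty_iff sinv_Asym)+
  ultimately show "a = c \<and> b = d"
    by (auto simp: doubleton_eq_iff)
qed

lemma corners_subset: "q \<in> GS \<alpha> \<beta> \<Longrightarrow> corners q \<subseteq> Asym \<alpha> \<times> Bsym \<beta>"
  by (auto simp: GS_def corners_gsquare)

lemma Lk_corners:
  assumes "R \<subseteq> GS \<alpha> \<beta>"
  shows "Lk \<alpha> \<beta> R = (Asym \<alpha> \<union> Bsym \<beta>, corner_edge ` \<Union>(corners ` R))"
proof -
  have "{square_edges a b a' b' | a b a' b'.
      a \<in> Asym \<alpha> \<and> a' \<in> Asym \<alpha> \<and> b \<in> Bsym \<beta> \<and> b' \<in> Bsym \<beta> \<and> gsquare a b a' b' \<in> R}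
    = (\<lambda>q. corner_edge ` corners q) ` R"
    using assms unfolding square_edges_corners GS_def by blast
  then show ?thesis
    unfolding Lk_def by (simp add: image_UN)
qed

lemma Lk_complete_bipartite_iff:
  assumes "R \<subseteq> GS \<alpha> \<beta>"
  shows "Lk \<alpha> \<beta> R = complete_bipartite (Asym \<alpha>) (Bsym \<beta>) \<longleftrightarrow>
    \<Union>(corners ` R) = Asym \<alpha> \<times> Bsym \<beta>"
proof -
  have "{{v, w} |v w. v \<in> Asym \<alpha> \<and> w \<in> Bsym \<beta>} = corner_edge ` (Asym \<alpha> \<times> Bsym \<beta>)"
  proof (intro equalityI subsetI)
    fix E assume "E \<in> {{v, w} |v w. v \<in> Asym \<alpha> \<and> w \<in> Bsym \<beta>}"
    then obtain v w where "E = corner_edge (sinv v, w)" "sinv v \<in> Asym \<alpha>" "w \<in> Bsym \<beta>"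
      by (auto simp: corner_edge_def)
    then show "E \<in> corner_edge ` (Asym \<alpha> \<times> Bsym \<beta>)"
      by blast
  next
    fix E assume "E \<in> corner_edge ` (Asym \<alpha> \<times> Bsym \<beta>)"
    then obtain a b where "E = {sinv a, b}" "sinv a \<in> Asym \<alpha>" "b \<in> Bsym \<beta>"
      by (auto simp: corner_edge_def)
    then show "E \<in> {{v, w} |v w. v \<in> Asym \<alpha> \<and> w \<in> Bsym \<beta>}"
      by blast
  qed
  moreover have "\<Union>(corners ` R) \<subseteq> Asym \<alpha> \<times> Bsym \<beta>"
    using assms corners_subset by blast
  ultimately show ?thesis
    unfolding Lk_corners[OF assms] complete_bipartite_def
    by (simp add: inj_on_image_eq_iff[OF inj_on_corner_edge])
qed

section \<open>BM relations as exact covers\<close>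

definition nondegenerate_squares :: "nat \<Rightarrow> nat \<Rightarrow> word set set" where
  "nondegenerate_squares \<alpha> \<beta> = {q \<in> GS \<alpha> \<beta>. card (corners q) = 4}"

lemma card_corners_le: "q \<in> GS \<alpha> \<beta> \<Longrightarrow> card (corners q) \<le> 4"
  by (auto simp: GS_def corners_gsquare card_insert_if)

lemma finite_corners: "q \<in> GS \<alpha> \<beta> \<Longrightarrow> finite (corners q)"
  by (auto simp: GS_def corners_gsquare)

lemma finite_GS: "finite (GS \<alpha> \<beta>)"
proof -
  have "GS \<alpha> \<beta> = (\<lambda>(a, b, a', b'). gsquare a b a' b') `
      (Asym \<alpha> \<times> Bsym \<beta> \<times> Asym \<alpha> \<times> Bsym \<beta>)"
    unfolding GS_def by (auto simp: image_iff)
  then show ?thesis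
    by simp
qed

text \<open>The equality case of the union bound. For a single \<open>q\<close>, the other members
  cover at most \<open>m * (card R - 1)\<close> points, so \<open>e q\<close> has to supply
  \<open>m\<close> new ones; as it has at most \<open>m\<close> points, it has exactly
  \<open>m\<close> and shares none.\<close>

lemma card_Union_tight:
  assumes "finite R" and le: "\<And>q. q \<in> R \<Longrightarrow> finite (e q) \<and> card (e q) \<le> m"
    and tight: "card (\<Union>(e ` R)) \<ge> m * card R"
  shows "disjoint_family_on e R" "\<And>q. q \<in> R \<Longrightarrow> card (e q) = m"
proof -
  have *: "card (e q \<inter> \<Union>(e ` (R - {q}))) = 0 \<and> card (e q) = m" if q: "q \<in> R" for q
  proof -
    let ?U = "\<Union>(e ` (R - {q}))"
    have fin: "finite (e q)" "finite ?U"
      using assms q by auto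
    have "card ?U \<le> (\<Sum>r\<in>R - {q}. card (e r))"
      using \<open>finite R\<close> by (intro card_UN_le) auto
    also have "\<dots> \<le> m * card (R - {q})"
      using sum_bounded_above[of "R - {q}" "\<lambda>r. card (e r)" m] le by (simp add: mult.commute)
    finally have U: "card ?U \<le> m * card (R - {q})" .
    have "\<Union>(e ` R) = e q \<union> ?U"
      using q by auto
    then have "m * card R \<le> card (e q \<union> ?U)"
      using tight by simp
    moreover have "card R = Suc (card (R - {q}))"
      using \<open>finite R\<close> q by (metis card.remove)
    ultimately have "m + m * card (R - {q}) + card (e q \<inter> ?U) \<le> card (e q) + card ?U"
      using card_Un_Int[OF fin] by simp
    with U le[OF q] show ?thesis
      by linarith
  qed
  then show "\<And>q. q \<in> R \<Longrightarrow> card (e q) = m"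
    by blast
  show "disjoint_family_on e R"
    unfolding disjoint_family_on_def
  proof (intro ballI impI)
    fix q r assume "q \<in> R" "r \<in> R" "q \<noteq> r"
    then have "e q \<inter> e r \<subseteq> e q \<inter> \<Union>(e ` (R - {q}))"
      by auto
    also have "\<dots> = {}"
      using *[OF \<open>q \<in> R\<close>] le[OF \<open>q \<in> R\<close>] by (metis card_0_eq finite_Int)
    finally show "e q \<inter> e r = {}"
      by blast
  qed
qed

lemma BM_relations_eq_exact_covers:
  "BM_relations \<alpha> \<beta> = exact_covers corners (nondegenerate_squares \<alpha> \<beta>) (Asym \<alpha> \<times> Bsym \<beta>)"
proof -
  have BM_iff: "BM_relation \<alpha> \<beta> R \<longleftrightarrow>
    R \<subseteq> GS \<alpha> \<beta> \<and> card R = \<alpha> * \<beta> \<and> \<Union>(corners ` R) = Asym \<alpha> \<times> Bsym \<beta>" for R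
    unfolding BM_relation_def by (metis Lk_complete_bipartite_iff)
  have cover_iff: "R \<in> exact_covers corners (nondegenerate_squares \<alpha> \<beta>) (Asym \<alpha> \<times> Bsym \<beta>) \<longleftrightarrow>
    R \<subseteq> GS \<alpha> \<beta> \<and> (disjoint_family_on corners R \<and> (\<forall>q\<in>R. card (corners q) = 4)) \<and>
    \<Union>(corners ` R) = Asym \<alpha> \<times> Bsym \<beta>" for R
    unfolding exact_covers_def nondegenerate_squares_def by blast
  have "BM_relation \<alpha> \<beta> R \<longleftrightarrow>
    R \<in> exact_covers corners (nondegenerate_squares \<alpha> \<beta>) (Asym \<alpha> \<times> Bsym \<beta>)" for R
  proof (cases "R \<subseteq> GS \<alpha> \<beta> \<and> \<Union>(corners ` R) = Asym \<alpha> \<times> Bsym \<beta>")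
    case False
    then show ?thesis
      unfolding BM_iff cover_iff by argo
  next
    case True
    then have R: "R \<subseteq> GS \<alpha> \<beta>" and U: "\<Union>(corners ` R) = Asym \<alpha> \<times> Bsym \<beta>"
      by auto
    have finR: "finite R"
      using R finite_GS by (rule finite_subset)
    have cardU: "card (\<Union>(corners ` R)) = 4 * (\<alpha> * \<beta>)"
      unfolding U by (simp add: card_cartesian_product card_Asym card_Bsym)
    \<comment> \<open>Forwards, the bound of four corners per square is tight; backwards, the sizes
      of disjoint corner sets add up.\<close>
    have "card R = \<alpha> * \<beta> \<longleftrightarrow> disjoint_family_on corners R \<and> (\<forall>q\<in>R. card (corners q) = 4)"
    proof
      assume "card R = \<alpha> * \<beta>"
      moreover have "\<And>q. q \<in> R \<Longrightarrow> finite (corners q) \<and> card (corners q) \<le> 4"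
        using R card_corners_le finite_corners by blast
      ultimately show "disjoint_family_on corners R \<and> (\<forall>q\<in>R. card (corners q) = 4)"
        using card_Union_tight[OF finR, of corners 4] cardU by auto
    next
      assume *: "disjoint_family_on corners R \<and> (\<forall>q\<in>R. card (corners q) = 4)"
      have "card (\<Union>(corners ` R)) = (\<Sum>q\<in>R. card (corners q))"
        using * R finite_corners by (intro card_UN_disjoint[OF finR])
          (auto simp: disjoint_family_on_def)
      also have "\<dots> = 4 * card R"
        using * by simp
      finally show "card R = \<alpha> * \<beta>"
        using cardU by simp
    qed
    then show ?thesis
      unfolding BM_iff cover_iff by argo
  qed
  then show ?thesis
    by (auto simp: BM_relations_def)
qed

section \<open>Squares over a single horizontal letter\<close>

abbreviation pa :: symbol where "pa \<equiv> Pos (La 1)"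
abbreviation na :: symbol where "na \<equiv> Neg (La 1)"

definition parallel_square :: "symbol \<Rightarrow> symbol \<Rightarrow> word set" where
  "parallel_square b c = gsquare pa b pa c"

definition crossing_square :: "symbol \<Rightarrow> symbol \<Rightarrow> word set" where
  "crossing_square b c = gsquare pa b na c"

text \<open>The condition \<open>b \<noteq> c\<close> expresses nondegeneracy: equal symbols would
  leave two corners only. A crossing square always has four, since a symbol differs from its
  inverse.\<close>

definition parallel_squares :: "symbol set \<Rightarrow> word set set" where
  "parallel_squares U = {parallel_square b c | b c. b \<in> U \<and> c \<in> U \<and> b \<noteq> c}"

definition crossing_squares :: "symbol set \<Rightarrow> word set set" where
  "crossing_squares U = {crossing_square b c | b c. b \<in> U \<and> c \<in> U}"

lemma corners_parallel_square:
  "corners (parallel_square b c) = {(pa, b), (pa, c), (na, sinv c), (na, sinv b)}"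
  by (simp add: parallel_square_def corners_gsquare)

lemma corners_crossing_square:
  "corners (crossing_square b c) = {(pa, b), (pa, sinv b), (na, c), (na, sinv c)}"
  by (auto simp: crossing_square_def corners_gsquare)

text \<open>This symmetry and the next one allow a square with the corner \<open>(pa, x)\<close> to
  be written with \<open>x\<close> in first place, as the two counting recursions require.\<close>

lemma parallel_square_commute: "parallel_square b c = parallel_square c b"
  by (auto simp: parallel_square_def gsquare_def)

lemma crossing_square_sinv: "crossing_square (sinv b) (sinv c) = crossing_square b c"
  by (auto simp: crossing_square_def gsquare_def)

lemma finite_parallel_squares: "finite U \<Longrightarrow> finite (parallel_squares U)"
  by (rule finite_subset[of _ "(\<lambda>(b, c). parallel_square b c) ` (U \<times> U)"])
    (auto simp: parallel_squares_def)

lemma finite_crossing_squares: "finite U \<Longrightarrow> finite (crossing_squares U)"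
  by (rule finite_subset[of _ "(\<lambda>(b, c). crossing_square b c) ` (U \<times> U)"])
    (auto simp: crossing_squares_def)

text \<open>The kinds differ in their words: in a parallel square each word repeats one horizontal
  symbol, in a crossing square each word contains both.\<close>

lemma parallel_crossing_disjoint: "parallel_squares U \<inter> crossing_squares V = {}"
proof -
  have "parallel_square b c \<noteq> crossing_square b' c'" for b c b' c'
  proof
    assume "parallel_square b c = crossing_square b' c'"
    moreover have "[pa, b', na, c'] \<in> crossing_square b' c'"
      by (simp add: crossing_square_def gsquare_def)
    ultimately have "[pa, b', na, c'] \<in> parallel_square b c"
      by simp
    then show False
      by (simp add: parallel_square_def gsquare_def)
  qed
  then show ?thesis
    unfolding parallel_squares_def crossing_squares_def by blast
qed

lemma Asym_1: "Asym 1 = {pa, na}"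
  by (simp add: Asym_def)

lemma nondegenerate_squares_1:
  "nondegenerate_squares 1 \<beta> = parallel_squares (Bsym \<beta>) \<union> crossing_squares (Bsym \<beta>)"
    (is "?L = ?R")
proof
  show "?L \<subseteq> ?R"
  proof
    fix q assume "q \<in> ?L"
    then obtain a b a' b' where q: "q = gsquare a b a' b'" and card: "card (corners q) = 4"
      and a: "a \<in> {pa, na}" "a' \<in> {pa, na}" and b: "b \<in> Bsym \<beta>" "b' \<in> Bsym \<beta>"
      unfolding nondegenerate_squares_def GS_def Asym_1 by blast
    have neq: "b \<noteq> b'" if "a = a'"
    proof
      assume "b = b'"
      then have "corners q = {(a, b), (sinv a, sinv b)}"
        using that by (simp add: q corners_gsquare)
      then show False
        using card by simp
    qed
    consider "a = pa" "a' = pa" | "a = na" "a' = na" | "a = pa" "a' = na" | "a = na" "a' = pa"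
      using a by auto
    then show "q \<in> ?R"
    proof cases
      case 1
      then show ?thesis
        using q b neq unfolding parallel_squares_def parallel_square_def by blast
    next
      case 2
      \<comment> \<open>Another word of the same square,
        \<open>[sinv a', sinv b, sinv a, sinv b']\<close>, begins with \<open>pa\<close>.\<close>
      then have "q = parallel_square (sinv b) (sinv b')"
        using q by (auto simp: parallel_square_def gsquare_def)
      then show ?thesis
        using 2 b neq unfolding parallel_squares_def
        by (intro UnI1 CollectI exI[of _ "sinv b"] exI[of _ "sinv b'"]) simp
    next
      case 3
      then show ?thesis
        using q b unfolding crossing_squares_def crossing_square_def by blast
    next
      case 4
      then have "q = crossing_square b' b"
        using q by (auto simp: crossing_square_def gsquare_def)
      then show ?thesis
        using b unfolding crossing_squares_def by blast
    qed
  qed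
  have "parallel_square b c \<in> ?L" if "b \<in> Bsym \<beta>" "c \<in> Bsym \<beta>" "b \<noteq> c" for b c
  proof -
    have "parallel_square b c \<in> GS 1 \<beta>"
      unfolding parallel_square_def GS_def Asym_1 using that by blast
    then show ?thesis
      using that by (simp add: nondegenerate_squares_def corners_parallel_square)
  qed
  moreover have "crossing_square b c \<in> ?L" if "b \<in> Bsym \<beta>" "c \<in> Bsym \<beta>" for b c
  proof -
    have "crossing_square b c \<in> GS 1 \<beta>"
      unfolding crossing_square_def GS_def Asym_1 using that by blast
    then show ?thesis
      using that by (simp add: nondegenerate_squares_def corners_crossing_square)
  qed
  ultimately show "?R \<subseteq> ?L"
    unfolding parallel_squares_def crossing_squares_def by blast
qed

section \<open>Counting covers by squares of one kind\<close>

text \<open>These covers are the perfect matchings of \<open>S\<close>: a parallel square is an edge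
  \<open>{b, c}\<close>, and its corners at \<open>na\<close> mirror those at \<open>pa\<close>
  under \<open>sinv\<close>. The family of squares stays over \<open>U\<close> while
  \<open>S\<close> shrinks in the induction.\<close>

lemma card_parallel_covers:
  assumes "finite U" "S \<subseteq> U" "card S = 2 * n"
  shows "card (exact_covers corners (parallel_squares U) ({pa} \<times> S \<union> {na} \<times> sinv ` S)) =
    (\<Prod>i<n. 2 * i + 1)"
  using assms(2,3)
proof (induction n arbitrary: S)
  case 0
  then have "S = {}"
    using \<open>finite U\<close> finite_subset by fastforce
  moreover have "corners q \<noteq> {}" if "q \<in> parallel_squares U" for q
    using that by (auto simp: parallel_squares_def corners_parallel_square)
  ultimately show ?case
    by (simp add: exact_covers_empty)
next
  case (Suc n)
  let ?X = "\<lambda>S. {pa} \<times> S \<union> {na} \<times> sinv ` S"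
  have finS: "finite S"
    using Suc.prems \<open>finite U\<close> finite_subset by blast
  from Suc.prems obtain x where x: "x \<in> S"
    by fastforce
  have choices: "{q \<in> parallel_squares U. (pa, x) \<in> corners q \<and> corners q \<subseteq> ?X S} =
      parallel_square x ` (S - {x})"
  proof (intro equalityI subsetI)
    fix q assume "q \<in> {q \<in> parallel_squares U. (pa, x) \<in> corners q \<and> corners q \<subseteq> ?X S}"
    moreover from this obtain b c where bc: "q = parallel_square b c" "b \<noteq> c"
      unfolding parallel_squares_def by blast
    ultimately have "x = b \<or> x = c" "b \<in> S" "c \<in> S"
      by (auto simp: corners_parallel_square)
    with bc show "q \<in> parallel_square x ` (S - {x})"
      by (metis Diff_iff empty_iff image_eqI insert_iff parallel_square_commute)
  next
    fix q assume "q \<in> parallel_square x ` (S - {x})"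
    then obtain c where c: "q = parallel_square x c" "c \<in> S" "x \<noteq> c"
      by blast
    then have "q \<in> parallel_squares U"
      using x Suc.prems(1) unfolding parallel_squares_def by blast
    with c x show "q \<in> {q \<in> parallel_squares U. (pa, x) \<in> corners q \<and> corners q \<subseteq> ?X S}"
      by (simp add: corners_parallel_square)
  qed
  have inj: "inj_on (parallel_square x) (S - {x})"
  proof (rule inj_onI)
    fix c d assume "c \<in> S - {x}" "d \<in> S - {x}" and eq: "parallel_square x c = parallel_square x d"
    have "(pa, c) \<in> corners (parallel_square x d)"
      unfolding eq[symmetric] corners_parallel_square by simp
    with \<open>c \<in> S - {x}\<close> show "c = d"
      by (simp add: corners_parallel_square)
  qed
  have "card (exact_covers corners (parallel_squares U) (?X S)) =
      (\<Sum>c\<in>S - {x}. card (exact_covers corners (parallel_squares U)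
        (?X S - corners (parallel_square x c))))"
    using x \<open>finite U\<close>
    by (subst card_exact_covers_choose[of "(pa, x)"])
      (simp_all only: choices sum.reindex[OF inj] comp_def finite_parallel_squares, simp)
  also have "\<dots> = (\<Sum>c\<in>S - {x}. \<Prod>i<n. 2 * i + 1)"
  proof (rule sum.cong[OF refl])
    fix c assume c: "c \<in> S - {x}"
    have "sinv ` (S - {x, c}) = sinv ` S - {sinv c, sinv x}"
      by (simp add: image_set_diff inj_def insert_commute)
    then have X: "?X S - corners (parallel_square x c) = ?X (S - {x, c})"
      unfolding corners_parallel_square by blast
    have "card {x, c} = 2"
      using c by (simp add: card_2_iff) blast
    then have "card (S - {x, c}) = 2 * n"
      using c x Suc.prems finS by (simp add: card_Diff_subset)
    moreover have "S - {x, c} \<subseteq> U"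
      using Suc.prems by blast
    ultimately show "card (exact_covers corners (parallel_squares U)
        (?X S - corners (parallel_square x c))) = (\<Prod>i<n. 2 * i + 1)"
      unfolding X by (intro Suc.IH)
  qed
  \<comment> \<open>Among the \<open>2 * n + 2\<close> elements of \<open>S\<close>,
    \<open>x\<close> has \<open>2 * n + 1\<close> possible partners.\<close>
  also have "\<dots> = (\<Prod>i<Suc n. 2 * i + 1)"
    using x Suc.prems finS by simp
  finally show ?case .
qed

text \<open>A crossing square joins a pair \<open>{b, sinv b}\<close> at \<open>pa\<close> to a pair
  \<open>{c, sinv c}\<close> at \<open>na\<close>, in one of two ways; a cover is thus a signed
  bijection between the \<open>n\<close> pairs in \<open>S\<close> and those in \<open>T\<close>.
  The two sets are kept apart because the induction removes different pairs from them.\<close>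

lemma card_crossing_covers:
  assumes "finite U" "S \<subseteq> U" "T \<subseteq> U" "sinv ` S \<subseteq> S" "sinv ` T \<subseteq> T"
    and "card S = 2 * n" "card T = 2 * n"
  shows "card (exact_covers corners (crossing_squares U) ({pa} \<times> S \<union> {na} \<times> T)) = 2 ^ n * fact n"
  using assms(2-)
proof (induction n arbitrary: S T)
  case 0
  then have "S = {}" "T = {}"
    using finite_subset[OF _ \<open>finite U\<close>] by simp_all
  moreover have "corners q \<noteq> {}" if "q \<in> crossing_squares U" for q
    using that by (auto simp: crossing_squares_def corners_crossing_square)
  ultimately show ?case
    by (simp add: exact_covers_empty)
next
  case (Suc n)
  let ?X = "\<lambda>S T. {pa} \<times> S \<union> {na} \<times> T"
  have fin: "finite S" "finite T"
    using Suc.prems(1,2) \<open>finite U\<close> by (simp_all add: finite_subset)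
  have "S \<noteq> {}"
    using Suc.prems(5) by auto
  then obtain x where x: "x \<in> S"
    by blast
  then have x': "sinv x \<in> S"
    using Suc.prems(3) by blast
  have choices: "{q \<in> crossing_squares U. (pa, x) \<in> corners q \<and> corners q \<subseteq> ?X S T} =
      crossing_square x ` T"
  proof (intro equalityI subsetI)
    fix q assume "q \<in> {q \<in> crossing_squares U. (pa, x) \<in> corners q \<and> corners q \<subseteq> ?X S T}"
    moreover from this obtain b c where q: "q = crossing_square b c"
      unfolding crossing_squares_def by blast
    ultimately have "x = b \<or> x = sinv b" "c \<in> T" "sinv c \<in> T"
      by (auto simp: corners_crossing_square)
    with q show "q \<in> crossing_square x ` T"
      by (metis image_eqI crossing_square_sinv)
  next
    fix q assume "q \<in> crossing_square x ` T"
    then obtain c where c: "q = crossing_square x c" "c \<in> T" "sinv c \<in> T"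
      using Suc.prems(4) by blast
    then have "q \<in> crossing_squares U"
      using x Suc.prems(1,2) unfolding crossing_squares_def by blast
    with c x x' show "q \<in> {q \<in> crossing_squares U. (pa, x) \<in> corners q \<and> corners q \<subseteq> ?X S T}"
      by (simp add: corners_crossing_square)
  qed
  \<comment> \<open>Corners cannot separate \<open>c\<close> from \<open>sinv c\<close> here, so the
    words are compared: the word starting with \<open>pa\<close>, \<open>x\<close> ends in
    \<open>c\<close>.\<close>
  have inj: "inj_on (crossing_square x) T"
  proof (rule inj_onI)
    fix c d assume "crossing_square x c = crossing_square x d"
    moreover have "[pa, x, na, c] \<in> crossing_square x c"
      by (simp add: crossing_square_def gsquare_def)
    ultimately have "[pa, x, na, c] \<in> crossing_square x d"
      by simp
    then show "c = d"
      by (simp add: crossing_square_def gsquare_def)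
  qed
  have "card (exact_covers corners (crossing_squares U) (?X S T)) =
      (\<Sum>c\<in>T. card (exact_covers corners (crossing_squares U)
        (?X S T - corners (crossing_square x c))))"
    using x \<open>finite U\<close>
    by (subst card_exact_covers_choose[of "(pa, x)"])
      (simp_all only: choices sum.reindex[OF inj] comp_def finite_crossing_squares, simp)
  also have "\<dots> = (\<Sum>c\<in>T. 2 ^ n * fact n)"
  proof (rule sum.cong[OF refl])
    fix c assume c: "c \<in> T"
    then have c': "sinv c \<in> T"
      using Suc.prems(4) by blast
    have closed: "sinv ` (V - {z, sinv z}) \<subseteq> V - {z, sinv z}" if "sinv ` V \<subseteq> V" for V z
    proof -
      have "sinv ` (V - {z, sinv z}) = sinv ` V - {sinv z, z}"
        by (simp add: image_set_diff inj_def)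
      then show ?thesis
        using that by blast
    qed
    have X: "?X S T - corners (crossing_square x c) = ?X (S - {x, sinv x}) (T - {c, sinv c})"
      unfolding corners_crossing_square by blast
    have "card (S - {x, sinv x}) = 2 * n" "card (T - {c, sinv c}) = 2 * n"
      using c c' x x' Suc.prems(5,6) fin by (simp_all add: card_Diff_subset)
    moreover have "S - {x, sinv x} \<subseteq> U" "T - {c, sinv c} \<subseteq> U"
      using Suc.prems(1,2) by blast+
    ultimately show "card (exact_covers corners (crossing_squares U)
        (?X S T - corners (crossing_square x c))) = 2 ^ n * fact n"
      unfolding X using Suc.prems(3,4) by (intro Suc.IH closed)
  qed
  \<comment> \<open>The partner \<open>c\<close> ranges over all \<open>2 * Suc n\<close> elements
    of \<open>T\<close>, which chooses a letter and a sign at once.\<close>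
  also have "\<dots> = 2 ^ Suc n * fact (Suc n)"
    using Suc.prems(6) by (simp add: algebra_simps)
  finally show ?case .
qed

section \<open>Separating parallel and crossing squares\<close>

text \<open>Extends \<open>Bsym\<close> to arbitrary index sets, since the letters of the crossing
  squares need not form an initial segment.\<close>

definition bsymbols :: "nat set \<Rightarrow> symbol set" where
  "bsymbols J = (\<Union>j\<in>J. {Pos (Lb j), Neg (Lb j)})"

lemma card_bsymbols: "finite J \<Longrightarrow> card (bsymbols J) = 2 * card J"
  unfolding bsymbols_def by (rule card_letters) (auto intro: injI)

lemma sinv_bsymbols [simp]: "sinv ` bsymbols J = bsymbols J"
proof -
  have "sinv ` bsymbols J = (\<Union>j\<in>J. sinv ` {Pos (Lb j), Neg (Lb j)})"
    unfolding bsymbols_def by blast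
  also have "\<dots> = bsymbols J"
    unfolding bsymbols_def by (simp add: insert_commute)
  finally show ?thesis .
qed

lemma bsymbols_iff [simp]:
  "Pos (Lb j) \<in> bsymbols J \<longleftrightarrow> j \<in> J" "Neg (Lb j) \<in> bsymbols J \<longleftrightarrow> j \<in> J"
  by (auto simp: bsymbols_def)

lemma inj_bsymbols: "inj bsymbols"
  by (rule injI) (metis bsymbols_iff(1) subsetI subset_antisym)

text \<open>The corners of one crossing square are closed under inverting the second entry, hence so
  is any region covered by such squares.\<close>

lemma crossing_corner_sinv:
  assumes "R \<in> exact_covers corners (crossing_squares U) Y" "(a, b) \<in> Y"
  shows "(a, sinv b) \<in> Y"
proof -
  obtain q where "q \<in> R" "(a, b) \<in> corners q" "q \<in> crossing_squares U" "corners q \<subseteq> Y"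
    using assms by (auto simp: exact_covers_def)
  then show ?thesis
    by (auto simp: crossing_squares_def corners_crossing_square)
qed

text \<open>For parallel squares the corresponding symmetry inverts both entries.\<close>

lemma parallel_corner_sinv:
  assumes "R \<in> exact_covers corners (parallel_squares U) Y" "(a, b) \<in> Y"
  shows "(sinv a, sinv b) \<in> Y"
proof -
  obtain q where "q \<in> R" "(a, b) \<in> corners q" "q \<in> parallel_squares U" "corners q \<subseteq> Y"
    using assms by (auto simp: exact_covers_def)
  then show ?thesis
    by (auto simp: parallel_squares_def corners_parallel_square)
qed

text \<open>The region \<open>Y\<close> is closed under inverting the second entry and its
  complement under inverting both. Together these symmetries permute the four corners of each letter
  transitively, so a letter lies in \<open>Y\<close> with all its corners or with none.\<close>

lemma crossing_part:
  assumes R: "R \<in> exact_covers corners (crossing_squares U) Y"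
    and R': "R' \<in> exact_covers corners (parallel_squares U) ({pa, na} \<times> bsymbols J - Y)"
    and Y: "Y \<subseteq> {pa, na} \<times> bsymbols J"
  obtains T where "T \<subseteq> J" "Y = {pa, na} \<times> bsymbols T"
proof
  let ?T = "{j \<in> J. (pa, Pos (Lb j)) \<in> Y}"
  show "?T \<subseteq> J"
    by blast
  have same_letter: "(a, Neg (Lb j)) \<in> Y \<longleftrightarrow> (a, Pos (Lb j)) \<in> Y" for a j
    using crossing_corner_sinv[OF R, of a "Pos (Lb j)"]
      crossing_corner_sinv[OF R, of a "Neg (Lb j)"] by auto
  have "(na, Neg (Lb j)) \<in> Y \<longleftrightarrow> (pa, Pos (Lb j)) \<in> Y" if "j \<in> J" for j
  proof -
    have "(pa, Pos (Lb j)) \<in> {pa, na} \<times> bsymbols J" "(na, Neg (Lb j)) \<in> {pa, na} \<times> bsymbols J"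
      using that by simp_all
    \<comment> \<open>Inverting both entries is an involution that preserves the complement of
      \<open>Y\<close>, so read contrapositively it preserves \<open>Y\<close> too.\<close>
    then show ?thesis
      using parallel_corner_sinv[OF R', of pa "Pos (Lb j)"]
        parallel_corner_sinv[OF R', of na "Neg (Lb j)"] by auto
  qed
  then have letter: "(a, b) \<in> Y \<longleftrightarrow> (pa, Pos (Lb j)) \<in> Y"
    if "j \<in> J" "a \<in> {pa, na}" "b \<in> {Pos (Lb j), Neg (Lb j)}" for a b j
    using same_letter that by blast
  show "Y = {pa, na} \<times> bsymbols ?T"
  proof (intro equalityI subrelI)
    fix a b assume ab: "(a, b) \<in> Y"
    then obtain j where "j \<in> J" "a \<in> {pa, na}" "b \<in> {Pos (Lb j), Neg (Lb j)}"
      using Y unfolding bsymbols_def by blast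
    with ab letter show "(a, b) \<in> {pa, na} \<times> bsymbols ?T"
      unfolding bsymbols_def by blast
  next
    fix a b assume "(a, b) \<in> {pa, na} \<times> bsymbols ?T"
    then obtain j where "j \<in> ?T" "a \<in> {pa, na}" "b \<in> {Pos (Lb j), Neg (Lb j)}"
      unfolding bsymbols_def by blast
    with letter show "(a, b) \<in> Y"
      by blast
  qed
qed

lemma card_BM_relations_1_sum:
  "card (BM_relations 1 \<beta>) =
    (\<Sum>T\<in>Pow {1..\<beta>}. (\<Prod>i<\<beta> - card T. 2 * i + 1) * (2 ^ card T * fact (card T)))"
proof -
  let ?J = "{1..\<beta>}"
  let ?B = "bsymbols ?J"
  let ?X = "{pa, na} \<times> ?B"
  let ?P = "\<lambda>Y. exact_covers corners (parallel_squares ?B) Y"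
  let ?C = "\<lambda>Y. exact_covers corners (crossing_squares ?B) Y"
  let ?Y = "\<lambda>T. {pa, na} \<times> bsymbols T"
  have B: "Bsym \<beta> = ?B"
    by (simp add: Bsym_def bsymbols_def)
  have finB: "finite ?B"
    by (simp add: bsymbols_def)
  have mono: "bsymbols T \<subseteq> ?B" if "T \<subseteq> ?J" for T
    using that by (auto simp: bsymbols_def)
  have inj: "inj_on ?Y (Pow ?J)"
    by (rule inj_onI) (metis inj_bsymbols injD insert_not_empty snd_image_times)
  have "card (BM_relations 1 \<beta>) = (\<Sum>Y\<in>Pow ?X. card (?P (?X - Y)) * card (?C Y))"
    unfolding BM_relations_eq_exact_covers nondegenerate_squares_1 Asym_1 B
    using finB by (intro card_exact_covers_Un finite_parallel_squares finite_crossing_squares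
        parallel_crossing_disjoint) auto
  \<comment> \<open>By \<open>crossing_part\<close>, any other region \<open>Y\<close> fails to have
    a crossing cover or its complement fails to have a parallel one, so its term vanishes.\<close>
  also have "\<dots> = (\<Sum>Y\<in>?Y ` Pow ?J. card (?P (?X - Y)) * card (?C Y))"
  proof (rule sum.mono_neutral_right)
    show "\<forall>Y\<in>Pow ?X - ?Y ` Pow ?J. card (?P (?X - Y)) * card (?C Y) = 0"
    proof (rule ballI, rule ccontr)
      fix Y assume Y: "Y \<in> Pow ?X - ?Y ` Pow ?J" and "card (?P (?X - Y)) * card (?C Y) \<noteq> 0"
      then have "?P (?X - Y) \<noteq> {}" "?C Y \<noteq> {}"
        by auto
      then obtain R R' where "R \<in> ?C Y" "R' \<in> ?P (?X - Y)"
        by blast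
      then obtain T where "T \<subseteq> ?J" "Y = ?Y T"
        using crossing_part Y by (metis DiffD1 PowD)
      then show False
        using Y by blast
    qed
  qed (use finB mono in auto)
  also have "\<dots> = (\<Sum>T\<in>Pow ?J. card (?P (?X - ?Y T)) * card (?C (?Y T)))"
    by (simp only: sum.reindex[OF inj] comp_def)
  also have "\<dots> = (\<Sum>T\<in>Pow ?J.
      (\<Prod>i<\<beta> - card T. 2 * i + 1) * (2 ^ card T * fact (card T)))"
  proof (rule sum.cong[OF refl])
    fix T assume "T \<in> Pow ?J"
    then have T: "T \<subseteq> ?J" and finT: "finite T"
      by (auto intro: finite_subset)
    \<comment> \<open>The mirrored shape that \<open>card_parallel_covers\<close> expects; inversion
      maps the symbol set to itself.\<close>
    have split: "?X - ?Y T = {pa} \<times> bsymbols (?J - T) \<union> {na} \<times> sinv ` bsymbols (?J - T)"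
      unfolding sinv_bsymbols by (auto simp: bsymbols_def)
    have "card (?P (?X - ?Y T)) = (\<Prod>i<\<beta> - card T. 2 * i + 1)"
      unfolding split using finB mono T finT
      by (intro card_parallel_covers) (auto simp: card_bsymbols card_Diff_subset)
    moreover have "?Y T = {pa} \<times> bsymbols T \<union> {na} \<times> bsymbols T"
      by auto
    then have "card (?C (?Y T)) = 2 ^ card T * fact (card T)"
      using card_crossing_covers[of ?B "bsymbols T" "bsymbols T" "card T"] finB mono[OF T] finT
      by (simp add: card_bsymbols)
    ultimately show "card (?P (?X - ?Y T)) * card (?C (?Y T)) =
        (\<Prod>i<\<beta> - card T. 2 * i + 1) * (2 ^ card T * fact (card T))"
      by simp
  qed
  finally show ?thesis .
qed

section \<open>Evaluation of the sum over letter sets\<close>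

lemma sum_Pow_card:
  fixes g :: "nat \<Rightarrow> nat"
  assumes "finite A"
  shows "(\<Sum>T\<in>Pow A. g (card T)) = (\<Sum>k\<le>card A. (card A choose k) * g k)"
proof -
  have "(\<Sum>T\<in>Pow A. g (card T)) = (\<Sum>k\<le>card A. \<Sum>T\<in>{T \<in> Pow A. card T = k}. g (card T))"
    using assms by (intro sum.group[symmetric]) (auto simp: card_mono)
  also have "\<dots> = (\<Sum>k\<le>card A. (card A choose k) * g k)"
    using assms by (intro sum.cong) (auto simp: n_subsets)
  finally show ?thesis .
qed

text \<open>The term for \<open>k = 0\<close> is the odd double factorial of \<open>2n - 1\<close>; absorption turns the
  remaining terms into \<open>2n\<close> times the sum for \<open>n - 1\<close>.\<close>

lemma sum_odd_prod_times_signed_permutations: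
  "(\<Sum>k\<le>n. (n choose k) * ((\<Prod>i<n - k. 2 * i + 1) * (2 ^ k * fact k))) =
    (\<Prod>i=1..n. 2 * i + 1 :: nat)"
proof (induction n)
  case 0
  show ?case by simp
next
  case (Suc n)
  let ?m = "\<lambda>n. \<Prod>i<n. 2 * i + 1 :: nat"
  have shift: "?m (Suc n) = (\<Prod>i=1..n. 2 * i + 1)"
    by (simp add: prod.lessThan_Suc_shift prod.atLeast1_atMost_eq del: prod.lessThan_Suc)
  have step: "(Suc n choose Suc k) * (?m (Suc n - Suc k) * (2 ^ Suc k * fact (Suc k))) =
      2 * Suc n * ((n choose k) * (?m (n - k) * (2 ^ k * fact k)))" for k
  proof -
    have "(Suc n choose Suc k) * (?m (Suc n - Suc k) * (2 ^ Suc k * fact (Suc k))) =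
        2 * (Suc k * (Suc n choose Suc k)) * (?m (n - k) * (2 ^ k * fact k))"
      by (simp only: diff_Suc_Suc power_Suc fact_Suc of_nat_id mult_ac)
    then show ?thesis
      by (simp only: Suc_times_binomial mult_ac)
  qed
  have "(\<Sum>k\<le>Suc n. (Suc n choose k) * (?m (Suc n - k) * (2 ^ k * fact k))) =
      ?m (Suc n) + 2 * Suc n * (\<Prod>i=1..n. 2 * i + 1)"
    unfolding sum.atMost_Suc_shift step sum_distrib_left[symmetric] Suc.IH by simp
  \<comment> \<open>The factor of \<open>?m (Suc n)\<close> at \<open>i = 0\<close> is 1, so both
    summands are multiples of the same product, and the new factor is
    \<open>1 + 2 * Suc n\<close>.\<close>
  also have "\<dots> = (\<Prod>i=1..Suc n. 2 * i + 1)"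
    unfolding shift by (simp add: algebra_simps)
  finally show ?case .
qed

theorem theorem7:
  fixes \<beta> :: nat
  assumes "\<beta> \<ge> 1"
  shows "card (BM_relations 1 \<beta>) = (\<Prod>i=1..\<beta>. 2 * i + 1)"
  using sum_Pow_card[of "{1..\<beta>}" "\<lambda>k. (\<Prod>i<\<beta> - k. 2 * i + 1) * (2 ^ k * fact k)"]
    sum_odd_prod_times_signed_permutations[of \<beta>]
  unfolding card_BM_relations_1_sum by simp

end
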